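(* Let $V$ be the $\mathcal O_q$-module, $L$ the Lusztig automorphism of $\mathcal O_q$, and $H\in\mathrm{End}(V)$ the invertible map described in the context. For every $X\in\mathcal O_q$ the following hold on $V$: $$L(X)=H^{-1}XH,\qquad L^{-1}(X)=HXH^{-1}.$$
   Context: Setting. $\mathbb F$ is a field and $q\in\mathbb F$ is nonzero and not a root of unity. Algebras are associative, unital, over $\mathbb F$. Write $[X,Y]=XY-YX$, $[X,Y]_q=qXY-q^{-1}YX$, $[X,Y]_{q^{-1}}=q^{-1}XY-qYX$. The $q$-Onsager algebra $\mathcal O_q$ is defined by generators $A,A^*$ and relations $[A,[A,[A,A^*]_q]_{q^{-1}}]=(q^2-q^{-2})^2[A^*,A]$ and $[A^*,[A^*,[A^*,A]_q]_{q^{-1}}]=(q^2-q^{-2})^2[A,A^*]$. $V$ is an irreducible $\mathcal O_q$-module of finite dimension at least $2$ on which each of $A,A^*$ is diagonalizable. Eigenspaces. The eigenvalues of $A$ on $V$ can be ordered as mutually distinct $\theta_0,\dots,\theta_d$ ($d\ge 1$) such that $\theta_i=aq^{d-2i}+a^{-1}q^{2i-d}$ ($0\le i\le d$) for some nonzero $a\in\mathbb F$; fix such an ordering and $a$. $V_i$ is the $\theta_i$-eigenspace of $A$ and $E_i\in\mathrm{End}(V)$ is the projection onto $V_i$ along $\bigoplus_{j\ne i}V_j$; one has $A^*V_i\subseteq V_{i-1}+V_i+V_{i+1}$ ($V_{-1}=V_{d+1}=0$). Lusztig automorphism. $L$ is the automorphism of $\mathcal O_q$ with $L(A)=A$, $L(A^*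 )=A^*+\frac{[A,[A,A^*]_q]}{(q-q^{-1})(q^2-q^{-2})}$; its inverse satisfies $L^{-1}(A)=A$, $L^{-1}(A^* )=A^*+\frac{[A,[A,A^*]_{q^{-1}}]}{(q-q^{-1})(q^2-q^{-2})}$ (existence is a theorem of Baseilhac and Kolb). The map $H$. Let $t_{ij}=1+\frac{\theta_i-\theta_j}{q-q^{-1}}\cdot\frac{q\theta_i-q^{-1}\theta_j}{q^2-q^{-2}}$, $t_i=t_{01}t_{12}\cdots t_{i-1,i}$ ($t_0=1$), and $H=\sum_{i=0}^d t_iE_i\in\mathrm{End}(V)$; each $t_i\neq0$, so $H$ is invertible. *)

theory Defs
  imports Complex_Main "HOL-Library.Poly_Mapping" "HOL-Algebra.QuotRing"
begin

section \<open>The free algebra on two generators\<close>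

datatype gen = gA | gAstar

datatype word = Word "gen list"

instantiation word :: monoid_add
begin

definition zero_word :: word where "0 = Word []"

fun plus_word :: "word \<Rightarrow> word \<Rightarrow> word" where
  "Word u + Word v = Word (u @ v)"

instance
proof
  fix a b c :: word
  show "a + b + c = a + (b + c)" by (cases a; cases b; cases c) simp
  show "0 + a = a" by (cases a) (simp add: zero_word_def)
  show "a + 0 = a" by (cases a) (simp add: zero_word_def)
qed

end

text \<open>The monoid of words is written additively, so that the convolution product on
  finitely supported functions \<^typ>\<open>word \<Rightarrow>\<^sub>0 'f\<close> extends concatenation of words. This type is
  the free associative unital algebra on \<open>gA\<close>, \<open>gAstar\<close> over \<^typ>\<open>'f\<close>.\<close>

type_synonym 'f free_alg = "word \<Rightarrow>\<^sub>0 'f"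

definition scalar :: "'f::field \<Rightarrow> 'f free_alg"
  where "scalar c = Poly_Mapping.single 0 c"

definition fA :: "'f::field free_alg"
  where "fA = Poly_Mapping.single (Word [gA]) 1"

definition fAstar :: "'f::field free_alg"
  where "fAstar = Poly_Mapping.single (Word [gAstar]) 1"

definition comm :: "'f::field free_alg \<Rightarrow> 'f free_alg \<Rightarrow> 'f free_alg"
  where "comm X Y = X * Y - Y * X"

definition qcomm :: "'f::field \<Rightarrow> 'f free_alg \<Rightarrow> 'f free_alg \<Rightarrow> 'f free_alg"
  where "qcomm q X Y = scalar q * X * Y - scalar (inverse q) * Y * X"

definition free_algebra :: "('f::field free_alg) ring"
  where "free_algebra =
    \<lparr>carrier = UNIV, mult = (*), one = 1, zero = 0, add = (+)\<rparr>"

lemma ring_free_algebra: "ring (free_algebra :: ('f::field free_alg) ring)"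
proof (rule ringI)
  show "abelian_group (free_algebra :: ('f free_alg) ring)"
  proof (rule abelian_groupI)
    fix x :: "'f free_alg"
    show "\<exists>y\<in>carrier free_algebra. y \<oplus>\<^bsub>free_algebra\<^esub> x = \<zero>\<^bsub>free_algebra\<^esub>"
      by (rule bexI[of _ "- x"]) (simp_all add: free_algebra_def)
  qed (simp_all add: free_algebra_def ac_simps)
  show "Group.monoid (free_algebra :: ('f free_alg) ring)"
    by (rule monoidI) (simp_all add: free_algebra_def mult.assoc)
qed (simp_all add: free_algebra_def distrib_left distrib_right)

section \<open>The q-Onsager algebra\<close>

definition q_dolan_grady :: "'f::field \<Rightarrow> 'f free_alg \<Rightarrow> 'f free_alg \<Rightarrow> 'f free_alg"
  where "q_dolan_grady q X Y =
    comm X (qcomm (inverse q) X (qcomm q X Y)) - scalar ((q\<^sup>2 - inverse q ^ 2)\<^sup>2) * comm Y X"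

definition Oq_ideal :: "'f::field \<Rightarrow> 'f free_alg set"
  where "Oq_ideal q = Idl\<^bsub>free_algebra\<^esub> {q_dolan_grady q fA fAstar, q_dolan_grady q fAstar fA}"

definition Oq :: "'f::field \<Rightarrow> ('f free_alg set) ring"
  where "Oq q = free_algebra Quot Oq_ideal q"

definition Oq_class :: "'f::field \<Rightarrow> 'f free_alg \<Rightarrow> 'f free_alg set"
  where "Oq_class q X = Oq_ideal q +>\<^bsub>free_algebra\<^esub> X"

lemma ring_Oq: "ring (Oq q)"
proof -
  have "ideal (Oq_ideal q) free_algebra"
    unfolding Oq_ideal_def
    by (rule ring.genideal_ideal[OF ring_free_algebra]) (simp add: free_algebra_def)
  then show ?thesis
    unfolding Oq_def by (rule ideal.quotient_is_ring)
qed

lemma Oq_class_hom: "Oq_class q \<in> ring_hom free_algebra (Oq q)"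
proof -
  have "ideal (Oq_ideal q) free_algebra"
    unfolding Oq_ideal_def
    by (rule ring.genideal_ideal[OF ring_free_algebra]) (simp add: free_algebra_def)
  from ideal.rcos_ring_hom[OF this] show ?thesis
    unfolding Oq_def Oq_class_def[abs_def] .
qed

abbreviation Oq_A :: "'f::field \<Rightarrow> 'f free_alg set"
  where "Oq_A q \<equiv> Oq_class q fA"

abbreviation Oq_Astar :: "'f::field \<Rightarrow> 'f free_alg set"
  where "Oq_Astar q \<equiv> Oq_class q fAstar"

text \<open>The algebra structure of \<open>Oq q\<close> over the ground field is given by the central ring
  homomorphism \<open>\<lambda>c. Oq_class q (scalar c)\<close>. A ring homomorphism on \<open>Oq q\<close> is therefore an
  algebra homomorphism iff it is compatible with these scalars. \<open>L\<close> is only relevant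
  on \<open>carrier (Oq q)\<close>. Since \<open>Oq_class q\<close> is a ring homomorphism, the
  bracket in the image of \<open>A\<^sup>*\<close> may be formed in the free algebra.\<close>

definition lusztig_automorphism :: "'f::field \<Rightarrow> ('f free_alg set \<Rightarrow> 'f free_alg set) \<Rightarrow> bool"
  where "lusztig_automorphism q L \<longleftrightarrow>
    L \<in> ring_iso (Oq q) (Oq q) \<and>
    (\<forall>c. L (Oq_class q (scalar c)) = Oq_class q (scalar c)) \<and>
    L (Oq_A q) = Oq_A q \<and>
    L (Oq_Astar q) =
      Oq_class q (fAstar + scalar (1 / ((q - inverse q) * (q\<^sup>2 - inverse q ^ 2)))
                             * comm fA (qcomm q fA fAstar))"

section \<open>Modules\<close>

definition End_ring :: "('f::field \<Rightarrow> 'v::ab_group_add \<Rightarrow> 'v) \<Rightarrow> ('v \<Rightarrow> 'v) ring"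
  where "End_ring scale =
    \<lparr>carrier = {T. Vector_Spaces.linear scale scale T}, mult = (\<circ>), one = id,
     zero = (\<lambda>v. 0), add = (\<lambda>S T v. S v + T v)\<rparr>"

definition Oq_module ::
    "'f::field \<Rightarrow> ('f \<Rightarrow> 'v::ab_group_add \<Rightarrow> 'v) \<Rightarrow> ('f free_alg set \<Rightarrow> 'v \<Rightarrow> 'v) \<Rightarrow> bool"
  where "Oq_module q scale \<rho> \<longleftrightarrow>
    vector_space scale \<and>
    \<rho> \<in> ring_hom (Oq q) (End_ring scale) \<and>
    (\<forall>c. \<rho> (Oq_class q (scalar c)) = scale c)"

definition irreducible_Oq_module ::
    "'f::field \<Rightarrow> ('f \<Rightarrow> 'v::ab_group_add \<Rightarrow> 'v) \<Rightarrow> ('f free_alg set \<Rightarrow> 'v \<Rightarrow> 'v) \<Rightarrow> bool"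
  where "irreducible_Oq_module q scale \<rho> \<longleftrightarrow>
    Oq_module q scale \<rho> \<and> (UNIV :: 'v set) \<noteq> {0} \<and>
    (\<forall>W. module.subspace scale W \<and> (\<forall>X\<in>carrier (Oq q). \<rho> X ` W \<subseteq> W) \<longrightarrow> W = {0} \<or> W = UNIV)"

section \<open>Eigenspaces\<close>

definition eigenspace :: "('f::field \<Rightarrow> 'v::ab_group_add \<Rightarrow> 'v) \<Rightarrow> ('v \<Rightarrow> 'v) \<Rightarrow> 'f \<Rightarrow> 'v set"
  where "eigenspace scale T c = {v. T v = scale c v}"

definition eigenvalues :: "('f::field \<Rightarrow> 'v::ab_group_add \<Rightarrow> 'v) \<Rightarrow> ('v \<Rightarrow> 'v) \<Rightarrow> 'f set"
  where "eigenvalues scale T = {c. \<exists>v. v \<noteq> 0 \<and> T v = scale c v}"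

definition diagonalizable :: "('f::field \<Rightarrow> 'v::ab_group_add \<Rightarrow> 'v) \<Rightarrow> ('v \<Rightarrow> 'v) \<Rightarrow> bool"
  where "diagonalizable scale T \<longleftrightarrow>
    (\<exists>B. \<not> module.dependent scale B \<and> module.span scale B = UNIV \<and>
         (\<forall>b\<in>B. \<exists>c. T b = scale c b))"

text \<open>Meaningful when the ambient space is the direct sum of \<open>U\<close> and \<open>W\<close>.\<close>

definition projection_along :: "'v::ab_group_add set \<Rightarrow> 'v set \<Rightarrow> 'v \<Rightarrow> 'v"
  where "projection_along U W v = (THE u. u \<in> U \<and> v - u \<in> W)"

definition eigenprojection ::
    "('f::field \<Rightarrow> 'v::ab_group_add \<Rightarrow> 'v) \<Rightarrow> ('v \<Rightarrow> 'v) \<Rightarrow> (nat \<Rightarrow> 'f) \<Rightarrow> nat \<Rightarrow> nat \<Rightarrow> 'v \<Rightarrow> 'v"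
  where "eigenprojection scale T \<theta> d i =
    projection_along (eigenspace scale T (\<theta> i))
      (module.span scale (\<Union>j\<in>{..d} - {i}. eigenspace scale T (\<theta> j)))"

section \<open>The map H\<close>

definition t2 :: "'f::field \<Rightarrow> (nat \<Rightarrow> 'f) \<Rightarrow> nat \<Rightarrow> nat \<Rightarrow> 'f"
  where "t2 q \<theta> i j =
    1 + (\<theta> i - \<theta> j) / (q - inverse q)
        * ((q * \<theta> i - inverse q * \<theta> j) / (q\<^sup>2 - inverse q ^ 2))"

definition t1 :: "'f::field \<Rightarrow> (nat \<Rightarrow> 'f) \<Rightarrow> nat \<Rightarrow> 'f"
  where "t1 q \<theta> i = (\<Prod>k=1..i. t2 q \<theta> (k - 1) k)"

definition H_map ::
    "'f::field \<Rightarrow> ('f \<Rightarrow> 'v::ab_group_add \<Rightarrow> 'v) \<Rightarrow> ('v \<Rightarrow> 'v) \<Rightarrow> (nat \<Rightarrow> 'f) \<Rightarrow> nat \<Rightarrow> 'v \<Rightarrow> 'v"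
  where "H_map q scale T \<theta> d v =
    (\<Sum>i\<le>d. scale (t1 q \<theta> i) (eigenprojection scale T \<theta> d i v))"

end

theory Submission
  imports Defs
begin

text \<open>Pull everything back to the free algebra. Both \<open>X \<mapsto> \<rho> X\<close> and \<open>X \<mapsto> \<rho> (L X)\<close> are
  representations of it on \<open>V\<close>, and \<open>L(X) = H\<^sup>-\<^sup>1 X H\<close> says that \<open>H\<close> intertwines them. As this property
  passes to sums and products, it is enough to verify it on scalars, \<open>A\<close> and \<open>A\<^sup>*\<close>
  (\<open>representations_intertwined\<close>). For \<open>A\<close> it holds because \<open>L\<close> fixes \<open>A\<close> and \<open>H\<close> is a scalar on each
  eigenspace of \<open>A\<close>. So the content is the identity \<open>H L(A\<^sup>*) = A\<^sup>* H\<close>.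

  Take \<open>v\<close> in the eigenspace \<open>V\<^sub>j\<close> and expand \<open>A\<^sup>* v = \<Sum>\<^sub>i u\<^sub>i\<close> with \<open>u\<^sub>i \<in> V\<^sub>i\<close>. Bracketing with \<open>A\<close> acts on
  this expansion coefficientwise: a commutator multiplies \<open>u\<^sub>i\<close> by \<open>\<theta>\<^sub>i - \<theta>\<^sub>j\<close>, a \<open>q\<close>-commutator
  by \<open>q \<theta>\<^sub>i - q\<^sup>-\<^sup>1 \<theta>\<^sub>j\<close>. Two consequences follow.

  First, the \<open>q\<close>-Dolan-Grady relation says that \<open>(\<theta>\<^sub>i - \<theta>\<^sub>j) P(\<theta>\<^sub>i,\<theta>\<^sub>j) u\<^sub>i = 0\<close> for an explicit quadratic
  polynomial \<open>P\<close>. For eigenvalues of the given form \<open>P(\<theta>\<^sub>i,\<theta>\<^sub>j)\<close> factors completely and does not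
  vanish when \<open>i\<close> and \<open>j\<close> differ by at least two, so \<open>u\<^sub>i = 0\<close> there (\<open>tridiagonal\<close>).

  Secondly, \<open>L(A\<^sup>*) v = \<Sum>\<^sub>i t\<^sub>i\<^sub>j u\<^sub>i\<close>, with exactly the numbers from which the weights of \<open>H\<close> are built.
  Hence \<open>H L(A\<^sup>*) v = \<Sum>\<^sub>i t\<^sub>i t\<^sub>i\<^sub>j u\<^sub>i\<close>, while \<open>A\<^sup>* H v = \<Sum>\<^sub>i t\<^sub>j u\<^sub>i\<close>, and it remains that
  \<open>t\<^sub>i t\<^sub>i\<^sub>j = t\<^sub>j\<close> for neighbouring \<open>i\<close> and \<open>j\<close> (\<open>t1_mult_t2\<close>). For \<open>j = i + 1\<close> this is the definition of \<open>t\<^sub>j\<close>;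
  for \<open>j = i - 1\<close> it is the identity \<open>t\<^sub>i\<^sub>j t\<^sub>j\<^sub>i = 1\<close>. The formula for \<open>L\<^sup>-\<^sup>1\<close> is that for \<open>L\<close>
  applied to \<open>L\<^sup>-\<^sup>1(X)\<close>.\<close>

section \<open>Eigenspace decompositions\<close>

lemma (in vector_space) in_span_UN_subspaces:
  assumes "finite S" "\<And>i. i \<in> S \<Longrightarrow> subspace (U i)" "v \<in> span (\<Union>i\<in>S. U i)"
  shows "\<exists>u. (\<forall>i\<in>S. u i \<in> U i) \<and> v = (\<Sum>i\<in>S. u i)"
  using assms(3)
proof (induction rule: span_induct_alt)
  case base
  show ?case
    using assms(2) by (intro exI[of _ "\<lambda>i. 0"]) (auto simp: subspace_0)
next
  case (step c x y)
  then obtain k u where k: "k \<in> S" "x \<in> U k" and u: "\<forall>i\<in>S. u i \<in> U i" "y = (\<Sum>i\<in>S. u i)"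
    by auto
  let ?w = "\<lambda>i. (if i = k then scale c x else 0) + u i"
  have "\<forall>i\<in>S. ?w i \<in> U i"
    using k u assms(2) by (auto intro!: subspace_add subspace_scale simp: subspace_0)
  moreover have "scale c x + y = (\<Sum>i\<in>S. ?w i)"
    using k u assms(1) by (simp add: sum.distrib sum.delta)
  ultimately show ?case
    by (intro exI[of _ ?w] conjI)
qed

locale eigenspace_decomposition = vector_space scale
  for scale :: "'f::field \<Rightarrow> 'v::ab_group_add \<Rightarrow> 'v" +
  fixes T :: "'v \<Rightarrow> 'v" and \<theta> :: "nat \<Rightarrow> 'f" and d :: nat
  assumes linear_T: "Vector_Spaces.linear scale scale T"
    and inj_eigenvalue: "inj_on \<theta> {..d}"
    and span_eigenspaces: "span (\<Union>i\<le>d. eigenspace scale T (\<theta> i)) = UNIV"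
begin

lemma T_hom: "module_hom scale scale T"
  using linear_T by (simp add: Vector_Spaces.linear_iff_module_hom)

lemmas T_scale = module_hom.scale[OF T_hom]
  and T_sum = module_hom.sum[OF T_hom]

abbreviation V :: "nat \<Rightarrow> 'v set"
  where "V i \<equiv> eigenspace scale T (\<theta> i)"

lemma subspace_V: "subspace (V i)"
  by (rule subspaceI)
    (simp_all add: eigenspace_def module_hom.zero[OF T_hom] module_hom.add[OF T_hom] T_scale
      scale_right_distrib mult.commute)

text \<open>Applying \<open>T - \<theta>\<^sub>k\<close> to a vanishing sum of eigenvectors removes the \<open>k\<close>-th term and
  rescales each other term by \<open>\<theta>\<^sub>i - \<theta>\<^sub>k \<noteq> 0\<close>, which allows induction on the index set.\<close>
lemma eigenvectors_independent:
  assumes "finite S" "S \<subseteq> {..d}" "\<And>i. i \<in> S \<Longrightarrow> u i \<in> V i" "(\<Sum>i\<in>S. u i) = 0" "i \<in> S"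
  shows "u i = 0"
  using assms
proof (induction S arbitrary: u i rule: finite_induct)
  case (insert k S)
  have Tu: "T (u i) = scale (\<theta> i) (u i)" if "i \<in> insert k S" for i
    using insert.prems(2)[OF that] by (simp add: eigenspace_def)
  have S0: "scale (\<theta> j - \<theta> k) (u j) = 0" if "j \<in> S" for j
  proof (rule insert.IH)
    show "scale (\<theta> i - \<theta> k) (u i) \<in> V i" if "i \<in> S" for i
      using insert.prems(2) that by (intro subspace_scale subspace_V) auto
    have "0 = T (\<Sum>i\<in>insert k S. u i) - scale (\<theta> k) (\<Sum>i\<in>insert k S. u i)"
      unfolding insert.prems(3) by (simp add: module_hom.zero[OF T_hom])
    also have "\<dots> = (\<Sum>i\<in>insert k S. scale (\<theta> i - \<theta> k) (u i))"
      unfolding T_sum scale_sum_right sum_subtractf[symmetric]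
      by (rule sum.cong) (simp_all add: Tu scale_left_diff_distrib)
    also have "\<dots> = (\<Sum>i\<in>S. scale (\<theta> i - \<theta> k) (u i))"
      using insert.hyps by simp
    finally show "(\<Sum>i\<in>S. scale (\<theta> i - \<theta> k) (u i)) = 0" ..
  qed (use insert.prems that in auto)
  have *: "u j = 0" if "j \<in> S" for j
  proof -
    have "\<theta> j \<noteq> \<theta> k"
      using insert.prems(1) insert.hyps(2) that inj_onD[OF inj_eigenvalue, of j k] by auto
    then show ?thesis
      using S0[OF that] by (simp add: scale_eq_0_iff)
  qed
  have "u k = 0"
    using insert.prems(3) insert.hyps * by simp
  with * show ?case
    using insert.prems(4) by blast
qed simp

lemma eigenvector_expansion: obtains u where "\<And>i. i \<le> d \<Longrightarrow> u i \<in> V i" "v = (\<Sum>i\<le>d. u i)"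
  using in_span_UN_subspaces[of "{..d}" V v] subspace_V span_eigenspaces by auto

text \<open>The projections are definite descriptions, so their value is known only once existence and
  uniqueness of the component in \<open>V i\<close> are established; uniqueness is independence of eigenvectors.\<close>
lemma eigenprojection_sum:
  assumes "i \<le> d" "\<And>j. j \<le> d \<Longrightarrow> u j \<in> V j"
  shows "eigenprojection scale T \<theta> d i (\<Sum>j\<le>d. u j) = u i"
  unfolding eigenprojection_def projection_along_def
proof (rule the_equality)
  have split: "(\<Sum>j\<le>d. u j) = u i + (\<Sum>j\<in>{..d} - {i}. u j)" for u :: "nat \<Rightarrow> 'v"
    using assms(1) by (simp add: sum.remove)
  have "(\<Sum>j\<in>{..d} - {i}. u j) \<in> span (\<Union>j\<in>{..d} - {i}. V j)"
    using assms(2) by (intro span_sum span_base) auto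
  then show "u i \<in> V i \<and> (\<Sum>j\<le>d. u j) - u i \<in> span (\<Union>j\<in>{..d} - {i}. V j)"
    using assms split by simp
  fix w
  assume w: "w \<in> V i \<and> (\<Sum>j\<le>d. u j) - w \<in> span (\<Union>j\<in>{..d} - {i}. V j)"
  then obtain z where z: "\<forall>j\<in>{..d} - {i}. z j \<in> V j"
    "(\<Sum>j\<le>d. u j) - w = (\<Sum>j\<in>{..d} - {i}. z j)"
    using in_span_UN_subspaces[of "{..d} - {i}" V] subspace_V by blast
  let ?y = "\<lambda>j. u j - (if j = i then w else z j)"
  have "?y i = 0"
  proof (rule eigenvectors_independent[of "{..d}" ?y])
    show "?y j \<in> V j" if "j \<in> {..d}" for j
      using that z(1) w assms(2) by (auto intro!: subspace_diff subspace_V)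
    have "(\<Sum>j\<le>d. if j = i then w else z j) = w + (\<Sum>j\<in>{..d} - {i}. z j)"
      by (subst split) simp
    then show "(\<Sum>j\<le>d. ?y j) = 0"
      using z(2) by (simp add: sum_subtractf algebra_simps)
  qed (use assms in auto)
  then show "w = u i"
    by simp
qed

text \<open>This coordinate description is what the remaining proofs use in place of the definition of
  \<open>H_map\<close>.\<close>
lemma H_map_sum:
  assumes "\<And>j. j \<le> d \<Longrightarrow> u j \<in> V j"
  shows "H_map q scale T \<theta> d (\<Sum>j\<le>d. u j) = (\<Sum>j\<le>d. scale (t1 q \<theta> j) (u j))"
  unfolding H_map_def using assms by (intro sum.cong refl) (simp add: eigenprojection_sum)

lemma linear_H_map: "Vector_Spaces.linear scale scale (H_map q scale T \<theta> d)"
proof -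
  let ?H = "H_map q scale T \<theta> d"
  have "?H (x + y) = ?H x + ?H y" for x y
  proof -
    obtain u where u: "\<And>i. i \<le> d \<Longrightarrow> u i \<in> V i" "x = (\<Sum>i\<le>d. u i)"
      by (rule eigenvector_expansion[of x]) auto
    obtain w where w: "\<And>i. i \<le> d \<Longrightarrow> w i \<in> V i" "y = (\<Sum>i\<le>d. w i)"
      by (rule eigenvector_expansion[of y]) auto
    have "?H (\<Sum>i\<le>d. u i + w i) = (\<Sum>i\<le>d. scale (t1 q \<theta> i) (u i + w i))"
      using u w by (intro H_map_sum subspace_add subspace_V) auto
    then show ?thesis
      using u w by (simp add: sum.distrib scale_right_distrib H_map_sum)
  qed
  moreover have "?H (scale c x) = scale c (?H x)" for c x
  proof -
    obtain u where u: "\<And>i. i \<le> d \<Longrightarrow> u i \<in> V i" "x = (\<Sum>i\<le>d. u i)"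
      by (rule eigenvector_expansion[of x]) auto
    have "?H (\<Sum>i\<le>d. scale c (u i)) = (\<Sum>i\<le>d. scale (t1 q \<theta> i) (scale c (u i)))"
      using u by (intro H_map_sum subspace_scale subspace_V) auto
    then show ?thesis
      using u by (simp add: scale_sum_right H_map_sum mult.commute)
  qed
  ultimately show ?thesis
    by (simp add: Vector_Spaces.linear_iff vector_space_axioms)
qed

lemma H_map_eigenvector:
  assumes "j \<le> d" "v \<in> V j"
  shows "H_map q scale T \<theta> d v = scale (t1 q \<theta> j) v"
proof -
  let ?u = "\<lambda>i. if i = j then v else 0"
  have "H_map q scale T \<theta> d (\<Sum>i\<le>d. ?u i) = (\<Sum>i\<le>d. scale (t1 q \<theta> i) (?u i))"
    using assms by (intro H_map_sum) (auto simp: subspace_0[OF subspace_V])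
  also have "\<dots> = (\<Sum>i\<le>d. if i = j then scale (t1 q \<theta> i) v else 0)"
    by (intro sum.cong) auto
  finally show ?thesis
    using assms(1) by simp
qed

lemma bij_H_map:
  assumes "\<And>i. i \<le> d \<Longrightarrow> t1 q \<theta> i \<noteq> 0"
  shows "bij (H_map q scale T \<theta> d)"
proof (rule bijI)
  let ?H = "H_map q scale T \<theta> d"
  have hom: "module_hom scale scale ?H"
    using linear_H_map by (simp add: Vector_Spaces.linear_iff_module_hom)
  have "x = 0" if "?H x = 0" for x
  proof -
    obtain u where u: "\<And>i. i \<le> d \<Longrightarrow> u i \<in> V i" "x = (\<Sum>i\<le>d. u i)"
      by (rule eigenvector_expansion[of x]) auto
    have "scale (t1 q \<theta> i) (u i) = 0" if "i \<le> d" for i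
    proof (rule eigenvectors_independent[of "{..d}" "\<lambda>i. scale (t1 q \<theta> i) (u i)"])
      show "(\<Sum>i\<le>d. scale (t1 q \<theta> i) (u i)) = 0"
        using \<open>?H x = 0\<close> u by (simp add: H_map_sum)
    qed (use that u in \<open>auto intro: subspace_scale subspace_V\<close>)
    then show ?thesis
      using assms u(2) by (simp add: scale_eq_0_iff)
  qed
  then have "x = y" if "?H x = ?H y" for x y
    using that module_hom.diff[OF hom, of x y] by (metis eq_iff_diff_eq_0)
  then show "inj ?H"
    by (rule injI)
  show "surj ?H"
  proof -
    have "v \<in> range ?H" for v
    proof -
      obtain u where u: "\<And>i. i \<le> d \<Longrightarrow> u i \<in> V i" "v = (\<Sum>i\<le>d. u i)"
        by (rule eigenvector_expansion[of v]) auto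
      have "?H (\<Sum>i\<le>d. scale (inverse (t1 q \<theta> i)) (u i)) =
          (\<Sum>i\<le>d. scale (t1 q \<theta> i) (scale (inverse (t1 q \<theta> i)) (u i)))"
        using u by (intro H_map_sum subspace_scale subspace_V) auto
      also have "\<dots> = v"
        unfolding u(2) using assms by (intro sum.cong) auto
      finally show ?thesis
        by (metis rangeI)
    qed
    then show ?thesis
      by blast
  qed
qed

lemma linear_eqI_eigenvectors:
  assumes "Vector_Spaces.linear scale scale f" "Vector_Spaces.linear scale scale g"
    and "\<And>j v. j \<le> d \<Longrightarrow> v \<in> V j \<Longrightarrow> f v = g v"
  shows "f = g"
proof
  fix v
  obtain u where u: "\<And>i. i \<le> d \<Longrightarrow> u i \<in> V i" "v = (\<Sum>i\<le>d. u i)"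
    by (rule eigenvector_expansion[of v]) auto
  show "f v = g v"
    using assms u by (simp add: Vector_Spaces.linear_iff_module_hom module_hom.sum)
qed

end

lemma diagonalizable_imp_span_eigenspaces:
  assumes "vector_space scale" "diagonalizable scale T" "eigenvalues scale T = \<theta> ` {..d}"
  shows "module.span scale (\<Union>i\<le>d. eigenspace scale T (\<theta> i)) = UNIV"
proof -
  interpret vector_space scale by fact
  obtain B where B: "\<not> dependent B" "span B = UNIV" "\<forall>b\<in>B. \<exists>c. T b = scale c b"
    using assms(2) unfolding diagonalizable_def by blast
  have "B \<subseteq> (\<Union>i\<le>d. eigenspace scale T (\<theta> i))"
  proof
    fix b
    assume b: "b \<in> B"
    then obtain c where c: "T b = scale c b"
      using B(3) by blast
    have "b \<noteq> 0"
      using b B(1) dependent_zero by blast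
    then have "c \<in> \<theta> ` {..d}"
      using c unfolding assms(3)[symmetric] eigenvalues_def by blast
    then show "b \<in> (\<Union>i\<le>d. eigenspace scale T (\<theta> i))"
      using c by (auto simp: eigenspace_def)
  qed
  then show ?thesis
    using span_mono B(2) by blast
qed

section \<open>The scalar identities\<close>

lemma power_int_inj_of_not_root_of_unity:
  fixes q :: "'f::field"
  assumes "q \<noteq> 0" "\<forall>n>0. q ^ n \<noteq> 1" "q powi m = q powi n"
  shows "m = n"
proof -
  have *: False if "m < n" "q powi m = q powi n" for m n :: int
  proof -
    have "q powi (n - m) = 1"
      using that assms(1) by (simp add: power_int_diff)
    moreover have "q powi (n - m) = q ^ nat (n - m)"
      using that(1) by (simp add: power_int_def)
    ultimately show False
      using assms(2) that(1) by simp
  qed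
  show ?thesis
    using *[of m n] *[of n m] assms(3) by (cases m n rule: linorder_cases) auto
qed

text \<open>The left-hand side is the polynomial \<open>P(X,Y) = X\<^sup>2 - (q\<^sup>2 + q\<^sup>-\<^sup>2) X Y + Y\<^sup>2 + (q\<^sup>2 - q\<^sup>-\<^sup>2)\<^sup>2\<close>. As a quadratic
  in \<open>Y\<close> its roots are \<open>z + z\<^sup>-\<^sup>1\<close> for \<open>z = q\<^sup>2 x\<close> and \<open>z = q\<^sup>-\<^sup>2 x\<close>, the would-be neighbours of \<open>X\<close> in the
  sequence of eigenvalues, and each factor splits further by
  \<open>Y - (z + z\<^sup>-\<^sup>1) = (y - z) (y z - 1) / (y z)\<close>.\<close>
lemma dolan_grady_coefficient_factorization:
  fixes q x y :: "'f::field"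
  assumes "q \<noteq> 0" "x \<noteq> 0" "y \<noteq> 0"
  defines "X \<equiv> x + inverse x" and "Y \<equiv> y + inverse y"
  shows "(inverse q * X - q * Y) * (q * X - inverse q * Y) + (q\<^sup>2 - inverse q ^ 2)\<^sup>2 =
    (y - q\<^sup>2 * x) * (y - x / q\<^sup>2) * (q\<^sup>2 * (x * y) - 1) * (x * y / q\<^sup>2 - 1) / (x * y)\<^sup>2"
  using assms(1-3) unfolding X_def Y_def
  by (simp add: field_simps power2_eq_square)

text \<open>If \<open>X\<close> and \<open>Y\<close> are successive eigenvalues, then \<open>X - Y\<close> is divisible by \<open>q - q\<^sup>-\<^sup>1\<close> and
  \<open>q X - q\<^sup>-\<^sup>1 Y\<close> by \<open>q\<^sup>2 - q\<^sup>-\<^sup>2\<close>. The two weights thereby become monomials that are inverse to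
  each other.\<close>
lemma adjacent_weight_values:
  fixes q x :: "'f::field"
  assumes "q \<noteq> 0" "x \<noteq> 0" "q\<^sup>2 \<noteq> 1" "q ^ 4 \<noteq> 1"
  defines "X \<equiv> x + inverse x" and "Y \<equiv> x / q\<^sup>2 + inverse (x / q\<^sup>2)"
  shows "1 + (X - Y) / (q - inverse q) * ((q * X - inverse q * Y) / (q\<^sup>2 - inverse q ^ 2))
      = x\<^sup>2 / q\<^sup>2"
    and "1 + (Y - X) / (q - inverse q) * ((q * Y - inverse q * X) / (q\<^sup>2 - inverse q ^ 2))
      = q\<^sup>2 / x\<^sup>2"
proof -
  have cancel: "1 + A * m / A * (B * n / B) = 1 + m * n" if "A \<noteq> 0" "B \<noteq> 0" for A B m n :: 'f
    using that by simp
  have nz: "q - inverse q \<noteq> 0" "q\<^sup>2 - inverse q ^ 2 \<noteq> 0"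
    using assms(1,3,4) by (auto simp: field_simps power2_eq_square power4_eq_xxxx)
  have d: "X - Y = (q - inverse q) * (x / q - q / x)"
    using assms(1,2) unfolding X_def Y_def by (simp add: field_simps power2_eq_square)
  have e1: "q * X - inverse q * Y = (q\<^sup>2 - inverse q ^ 2) * (x / q)"
    using assms(1,2) unfolding X_def Y_def by (simp add: field_simps power2_eq_square)
  have e2: "q * Y - inverse q * X = (q\<^sup>2 - inverse q ^ 2) * (q / x)"
    using assms(1,2) unfolding X_def Y_def by (simp add: field_simps power2_eq_square)
  show "1 + (X - Y) / (q - inverse q) * ((q * X - inverse q * Y) / (q\<^sup>2 - inverse q ^ 2))
      = x\<^sup>2 / q\<^sup>2"
    unfolding d e1 cancel[OF nz] using assms(1,2) by (simp add: field_simps power2_eq_square)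
  have d': "Y - X = (q - inverse q) * (q / x - x / q)"
    using d by (simp add: algebra_simps)
  show "1 + (Y - X) / (q - inverse q) * ((q * Y - inverse q * X) / (q\<^sup>2 - inverse q ^ 2))
      = q\<^sup>2 / x\<^sup>2"
    unfolding d' e2 cancel[OF nz] using assms(1,2) by (simp add: field_simps power2_eq_square)
qed

locale q_racah_eigenvalues =
  fixes q a :: "'f::field" and \<theta> :: "nat \<Rightarrow> 'f" and d :: nat
  assumes q_nonzero: "q \<noteq> 0"
    and q_not_root_of_unity: "\<forall>n>0. q ^ n \<noteq> 1"
    and a_nonzero: "a \<noteq> 0"
    and inj_theta: "inj_on \<theta> {..d}"
    and theta_eq: "\<forall>i\<le>d. \<theta> i = a * q powi (int d - 2 * int i) + inverse a * q powi (2 * int i - int d)"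
begin

text \<open>A parameter uniformizing the eigenvalues, \<open>\<theta>\<^sub>i = x\<^sub>i + x\<^sub>i\<^sup>-\<^sup>1\<close>. It is defined for all \<open>i\<close>, so that
  shifted indices beyond \<open>d\<close> may be used.\<close>
definition x :: "nat \<Rightarrow> 'f"
  where "x i = a * q powi (int d - 2 * int i)"

lemma x_nonzero: "x i \<noteq> 0"
  using q_nonzero a_nonzero by (simp add: x_def power_int_not_zero)

lemma theta_x: "i \<le> d \<Longrightarrow> \<theta> i = x i + inverse (x i)"
  using theta_eq by (simp add: x_def power_int_minus[symmetric])

lemma x_Suc: "x (Suc i) = x i / q\<^sup>2"
proof -
  have "q powi (int d - 2 * int i - 2) = q powi (int d - 2 * int i) / q powi 2"
    using q_nonzero by (rule power_int_diff[OF disjI1])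
  then have "q powi (int d - 2 * int (Suc i)) = q powi (int d - 2 * int i) / q\<^sup>2"
    by (simp add: algebra_simps)
  then show ?thesis
    by (simp only: x_def times_divide_eq_right)
qed

lemma inj_x: "x i = x j \<Longrightarrow> i = j"
  using power_int_inj_of_not_root_of_unity[OF q_nonzero q_not_root_of_unity] a_nonzero
  by (fastforce simp: x_def)

text \<open>The numbers \<open>x\<close> and \<open>x\<^sup>-\<^sup>1\<close> give the same eigenvalue, so distinctness of the eigenvalues
  excludes these products.\<close>
lemma x_mult_neq_1:
  assumes "i \<le> d" "j \<le> d" "i \<noteq> j"
  shows "x i * x j \<noteq> 1"
proof
  assume "x i * x j = 1"
  then have "x j = inverse (x i)"
    by (metis inverse_unique)
  then have "\<theta> i = \<theta> j"
    using assms by (simp add: theta_x)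
  then show False
    using assms inj_onD[OF inj_theta, of i j] by simp
qed

text \<open>Each of the four factors of the coefficient is nonzero. The first two are excluded by
  injectivity of \<open>x\<close>. For the last two, \<open>x\<^sub>i x\<^sub>j\<close> depends only on \<open>i + j\<close>; as \<open>i\<close> and \<open>j\<close> are at least two
  apart, one index can be moved towards the other by one, which keeps both in range and distinct and
  reduces the claim to \<open>x_mult_neq_1\<close>.\<close>
lemma dolan_grady_coefficient_nonzero_less:
  assumes "Suc i < j" "j \<le> d"
  shows "(inverse q * \<theta> i - q * \<theta> j) * (q * \<theta> i - inverse q * \<theta> j) + (q\<^sup>2 - inverse q ^ 2)\<^sup>2 \<noteq> 0"
proof -
  obtain k where k: "j = Suc k"
    using assms by (cases j) auto
  have "x j \<noteq> q\<^sup>2 * x i"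
  proof
    assume "x j = q\<^sup>2 * x i"
    then have "x (Suc j) = x i"
      using q_nonzero by (simp add: x_Suc)
    then show False
      using inj_x assms by fastforce
  qed
  moreover have "x j \<noteq> x i / q\<^sup>2"
    using inj_x[of j "Suc i"] assms by (auto simp: x_Suc)
  moreover have "q\<^sup>2 * (x i * x j) \<noteq> 1"
    using x_mult_neq_1[of i k] assms q_nonzero by (simp add: k x_Suc)
  moreover have "x i * x j / q\<^sup>2 \<noteq> 1"
    using x_mult_neq_1[of "Suc i" j] assms by (simp add: x_Suc)
  ultimately show ?thesis
    using assms dolan_grady_coefficient_factorization[OF q_nonzero x_nonzero x_nonzero, of i j]
    by (simp add: theta_x x_nonzero)
qed

lemma dolan_grady_coefficient_nonzero:
  assumes "i \<le> d" "j \<le> d" "Suc i < j \<or> Suc j < i"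
  shows "(inverse q * \<theta> i - q * \<theta> j) * (q * \<theta> i - inverse q * \<theta> j) + (q\<^sup>2 - inverse q ^ 2)\<^sup>2 \<noteq> 0"
  using assms(3)
proof
  assume "Suc j < i"
  from dolan_grady_coefficient_nonzero_less[OF this assms(1)] show ?thesis
    by (simp add: algebra_simps)
qed (rule dolan_grady_coefficient_nonzero_less[OF _ assms(2)])

lemma t2_adjacent:
  assumes "Suc i \<le> d"
  shows "t2 q \<theta> i (Suc i) = (x i)\<^sup>2 / q\<^sup>2" "t2 q \<theta> (Suc i) i = q\<^sup>2 / (x i)\<^sup>2"
proof -
  have "q\<^sup>2 \<noteq> 1" "q ^ 4 \<noteq> 1"
    using q_not_root_of_unity by simp_all
  note adjacent_weight_values[OF q_nonzero x_nonzero this, of i]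
  with assms show "t2 q \<theta> i (Suc i) = (x i)\<^sup>2 / q\<^sup>2" "t2 q \<theta> (Suc i) i = q\<^sup>2 / (x i)\<^sup>2"
    by (simp_all add: t2_def theta_x x_Suc)
qed

lemma t2_self: "t2 q \<theta> i i = 1"
  by (simp add: t2_def)

lemma t1_Suc: "t1 q \<theta> (Suc i) = t1 q \<theta> i * t2 q \<theta> i (Suc i)"
  by (simp add: t1_def)

lemma t1_nonzero: "i \<le> d \<Longrightarrow> t1 q \<theta> i \<noteq> 0"
proof (induction i)
  case (Suc i)
  then show ?case
    using q_nonzero x_nonzero by (simp add: t1_Suc t2_adjacent)
qed (simp add: t1_def)

text \<open>The matrix identity behind \<open>L(A\<^sup>*) = H\<^sup>-\<^sup>1 A\<^sup>* H\<close>, restricted to the band where \<open>A\<^sup>*\<close> can have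
  nonzero blocks.\<close>
lemma t1_mult_t2:
  assumes "i \<le> d" "j \<le> d" "\<not> Suc i < j" "\<not> Suc j < i"
  shows "t1 q \<theta> i * t2 q \<theta> i j = t1 q \<theta> j"
proof -
  consider "i = j" | "j = Suc i" | "i = Suc j"
    using assms by linarith
  then show ?thesis
    by cases (use assms q_nonzero x_nonzero in \<open>auto simp: t2_self t1_Suc t2_adjacent\<close>)
qed

end

section \<open>Representations of the free algebra\<close>

text \<open>Working with representations of the free algebra instead of \<open>Oq q\<close> makes brackets ordinary
  ring expressions and provides induction over words.\<close>
locale free_algebra_representation = vector_space scale
  for scale :: "'f::field \<Rightarrow> 'v::ab_group_add \<Rightarrow> 'v" +
  fixes R :: "'f free_alg \<Rightarrow> 'v \<Rightarrow> 'v"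
  assumes rep_linear: "Vector_Spaces.linear scale scale (R X)"
    and rep_add: "R (X + Y) v = R X v + R Y v"
    and rep_mult: "R (X * Y) v = R X (R Y v)"
    and rep_scalar: "R (scalar c) v = scale c v"
begin

lemma rep_hom: "module_hom scale scale (R X)"
  using rep_linear by (simp add: Vector_Spaces.linear_iff_module_hom)

lemmas rep_scale = module_hom.scale[OF rep_hom]
  and rep_sum = module_hom.sum[OF rep_hom]

lemma rep_diff: "R (X - Y) v = R X v - R Y v"
  using rep_add[of "X - Y" Y v] by (simp add: algebra_simps)

lemma rep_comm: "R (comm X Y) v = R X (R Y v) - R Y (R X v)"
  by (simp add: comm_def rep_diff rep_mult)

lemma rep_qcomm: "R (qcomm p X Y) v = scale p (R X (R Y v)) - scale (inverse p) (R Y (R X v))"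
  by (simp add: qcomm_def rep_diff rep_mult rep_scalar)

text \<open>The input and the output have the same form, so this lemma and the next one can be chained to
  evaluate nested brackets on an eigenvector.\<close>
lemma rep_comm_eigenvector:
  assumes "R fA v = scale c v" "\<And>i. i \<in> I \<Longrightarrow> R fA (u i) = scale (\<theta> i) (u i)"
    and "R Y v = (\<Sum>i\<in>I. scale (y i) (u i))"
  shows "R (comm fA Y) v = (\<Sum>i\<in>I. scale ((\<theta> i - c) * y i) (u i))"
  unfolding rep_comm assms(1) rep_scale assms(3) rep_sum scale_sum_right sum_subtractf[symmetric]
  using assms(2) by (intro sum.cong) (auto simp: algebra_simps)

lemma rep_qcomm_eigenvector:
  assumes "R fA v = scale c v" "\<And>i. i \<in> I \<Longrightarrow> R fA (u i) = scale (\<theta> i) (u i)"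
    and "R Y v = (\<Sum>i\<in>I. scale (y i) (u i))"
  shows "R (qcomm p fA Y) v = (\<Sum>i\<in>I. scale ((p * \<theta> i - inverse p * c) * y i) (u i))"
  unfolding rep_qcomm assms(1) rep_scale assms(3) rep_sum scale_sum_right sum_subtractf[symmetric]
  using assms(2) by (intro sum.cong) (auto simp: algebra_simps)

end

lemma free_alg_single_Cons:
  "Poly_Mapping.single (Word (g # w)) c =
    (case g of gA \<Rightarrow> fA | gAstar \<Rightarrow> fAstar) * (Poly_Mapping.single (Word w) c :: 'f::field free_alg)"
  by (cases g) (simp_all add: fA_def fAstar_def mult_single)

lemma free_alg_induct [case_names add mult scalar fA fAstar]:
  fixes X :: "'f::field free_alg"
  assumes add: "\<And>X Y. P X \<Longrightarrow> P Y \<Longrightarrow> P (X + Y)"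
    and mult: "\<And>X Y. P X \<Longrightarrow> P Y \<Longrightarrow> P (X * Y)"
    and scalar: "\<And>c. P (scalar c)"
    and fA: "P fA" and fAstar: "P fAstar"
  shows "P X"
proof (induction X rule: update_induct)
  case const
  show ?case
    using scalar[of 0] by (simp add: scalar_def)
next
  case (update f a b)
  have "P (Poly_Mapping.single (Word w) b)" for w
  proof (induction w)
    case Nil
    show ?case
      using scalar[of b] by (simp add: scalar_def zero_word_def)
  next
    case (Cons g w)
    then show ?case
      unfolding free_alg_single_Cons by (intro mult) (simp_all add: fA fAstar split: gen.split)
  qed
  then have "P (f + Poly_Mapping.single a b)"
    using add update.IH by (cases a) blast
  moreover have "Poly_Mapping.update a b f = f + Poly_Mapping.single a b"
    using update.hyps(1) by (intro poly_mapping_eqI)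
      (auto simp: lookup_update lookup_add lookup_single when_def in_keys_iff)
  ultimately show ?case
    by simp
qed

text \<open>The elements on which \<open>H\<close> intertwines the two representations form a subalgebra.\<close>
lemma representations_intertwined:
  assumes "free_algebra_representation scale R" "free_algebra_representation scale R'"
    and H: "Vector_Spaces.linear scale scale H"
    and "H \<circ> R' fA = R fA \<circ> H" "H \<circ> R' fAstar = R fAstar \<circ> H"
  shows "H \<circ> R' X = R X \<circ> H"
proof -
  interpret R: free_algebra_representation scale R by fact
  interpret R': free_algebra_representation scale R' by fact
  note H_hom = H[unfolded Vector_Spaces.linear_iff_module_hom]
  have "\<forall>v. H (R' X v) = R X (H v)"
  proof (induction X rule: free_alg_induct)
    case (add X Y)
    then show ?case
      by (simp add: R.rep_add R'.rep_add module_hom.add[OF H_hom])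
  next
    case (mult X Y)
    then show ?case
      by (simp add: R.rep_mult R'.rep_mult)
  next
    case (scalar c)
    show ?case
      by (simp add: R.rep_scalar R'.rep_scalar module_hom.scale[OF H_hom])
  qed (use assms(4,5) in \<open>simp_all add: fun_eq_iff\<close>)
  then show ?thesis
    by auto
qed

section \<open>Conjugation by H on the generators\<close>

locale dolan_grady_representation =
  free_algebra_representation scale R +
  eigenspace_decomposition scale "R fA" \<theta> d +
  q_racah_eigenvalues q a \<theta> d
  for scale :: "'f::field \<Rightarrow> 'v::ab_group_add \<Rightarrow> 'v"
    and R :: "'f free_alg \<Rightarrow> 'v \<Rightarrow> 'v" and q a :: 'f and \<theta> :: "nat \<Rightarrow> 'f" and d :: nat +
  assumes dolan_grady: "R (q_dolan_grady q fA fAstar) v = 0"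
begin

text \<open>The first Dolan-Grady relation, evaluated on \<open>v\<close>, rescales every component \<open>u i\<close> by a scalar, so
  by independence each rescaled component vanishes; away from the band the scalar is nonzero.\<close>
lemma tridiagonal:
  assumes "j \<le> d" "v \<in> V j" "\<And>i. i \<le> d \<Longrightarrow> u i \<in> V i" "R fAstar v = (\<Sum>i\<le>d. u i)"
    and "i \<le> d" "Suc i < j \<or> Suc j < i"
  shows "u i = 0"
proof -
  let ?\<kappa> = "(q\<^sup>2 - inverse q ^ 2)\<^sup>2"
  let ?c = "\<lambda>i. (\<theta> i - \<theta> j) *
    ((inverse q * \<theta> i - q * \<theta> j) * (q * \<theta> i - inverse q * \<theta> j) + ?\<kappa>)"
  have v: "R fA v = scale (\<theta> j) v"
    using assms(2) by (simp add: eigenspace_def)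
  have u: "R fA (u i) = scale (\<theta> i) (u i)" if "i \<in> {..d}" for i
    using assms(3) that by (simp add: eigenspace_def)
  have B: "R fAstar v = (\<Sum>i\<le>d. scale 1 (u i))"
    by (simp add: assms(4))
  have C: "R (comm fA fAstar) v = (\<Sum>i\<le>d. scale ((\<theta> i - \<theta> j) * 1) (u i))"
    by (rule rep_comm_eigenvector[OF v u B])
  have D: "R (comm fA (qcomm (inverse q) fA (qcomm q fA fAstar))) v =
    (\<Sum>i\<le>d. scale ((\<theta> i - \<theta> j) * ((inverse q * \<theta> i - inverse (inverse q) * \<theta> j) *
      ((q * \<theta> i - inverse q * \<theta> j) * 1))) (u i))"
    by (intro rep_comm_eigenvector rep_qcomm_eigenvector v u B)
  have "R (comm fAstar fA) v = - R (comm fA fAstar) v"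
    by (simp add: rep_comm)
  then have "R (q_dolan_grady q fA fAstar) v =
      R (comm fA (qcomm (inverse q) fA (qcomm q fA fAstar))) v + scale ?\<kappa> (R (comm fA fAstar) v)"
    by (simp add: q_dolan_grady_def rep_diff rep_mult rep_scalar)
  also have "\<dots> = (\<Sum>i\<le>d. scale (?c i) (u i))"
    unfolding C D scale_sum_right sum.distrib[symmetric]
    by (intro sum.cong refl) (simp add: scale_left_distrib[symmetric] distrib_left mult.commute)
  finally have "(\<Sum>i\<le>d. scale (?c i) (u i)) = 0"
    by (simp add: dolan_grady)
  then have "scale (?c i) (u i) = 0"
    using assms(3,5) by (intro eigenvectors_independent[of "{..d}" "\<lambda>i. scale (?c i) (u i)"])
      (auto intro: subspace_scale subspace_V)
  moreover have "\<theta> i - \<theta> j \<noteq> 0"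
    using inj_onD[OF inj_theta, of i j] assms(1,5,6) by auto
  ultimately show ?thesis
    using dolan_grady_coefficient_nonzero[OF assms(5,1,6)] by (simp add: scale_eq_0_iff)
qed

lemma H_map_commutes_fA: "H_map q scale (R fA) \<theta> d \<circ> R fA = R fA \<circ> H_map q scale (R fA) \<theta> d"
proof (rule linear_eqI_eigenvectors)
  fix j v
  assume "j \<le> d" "v \<in> V j"
  then show "(H_map q scale (R fA) \<theta> d \<circ> R fA) v = (R fA \<circ> H_map q scale (R fA) \<theta> d) v"
    using linear_H_map by (simp add: H_map_eigenvector eigenspace_def rep_scale
        Vector_Spaces.linear_iff mult.commute)
qed (rule Vector_Spaces.linear_compose[OF rep_linear linear_H_map]
  Vector_Spaces.linear_compose[OF linear_H_map rep_linear])+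

text \<open>The coefficient of \<open>u\<^sub>i\<close> in \<open>L(A\<^sup>*) v\<close> is exactly \<open>t\<^sub>i\<^sub>j\<close>: this is where the shape of
  the Lusztig automorphism and the shape of the weights of \<open>H\<close> match.\<close>
lemma H_map_intertwines_fAstar:
  "H_map q scale (R fA) \<theta> d \<circ> R (fAstar + scalar (1 / ((q - inverse q) * (q\<^sup>2 - inverse q ^ 2)))
      * comm fA (qcomm q fA fAstar))
    = R fAstar \<circ> H_map q scale (R fA) \<theta> d" (is "?H \<circ> R ?L = _")
proof (rule linear_eqI_eigenvectors)
  fix j v
  assume jv: "j \<le> d" "v \<in> V j"
  obtain u where u: "\<And>i. i \<le> d \<Longrightarrow> u i \<in> V i" "R fAstar v = (\<Sum>i\<le>d. u i)"
    by (rule eigenvector_expansion[of "R fAstar v"]) auto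
  have v: "R fA v = scale (\<theta> j) v"
    using jv by (simp add: eigenspace_def)
  have u': "R fA (u i) = scale (\<theta> i) (u i)" if "i \<in> {..d}" for i
    using u that by (simp add: eigenspace_def)
  have B: "R fAstar v = (\<Sum>i\<le>d. scale 1 (u i))"
    by (simp add: u(2))
  have "R (comm fA (qcomm q fA fAstar)) v =
      (\<Sum>i\<le>d. scale ((\<theta> i - \<theta> j) * ((q * \<theta> i - inverse q * \<theta> j) * 1)) (u i))"
    by (intro rep_comm_eigenvector rep_qcomm_eigenvector v u' B)
  then have "R ?L v = (\<Sum>i\<le>d. scale (t2 q \<theta> i j) (u i))"
    by (simp add: rep_add rep_mult rep_scalar B scale_sum_right sum.distrib[symmetric]
        t2_def scale_left_distrib)
  then have "?H (R ?L v) = (\<Sum>i\<le>d. scale (t1 q \<theta> i) (scale (t2 q \<theta> i j) (u i)))"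
    using u(1) by (simp add: H_map_sum subspace_scale[OF subspace_V])
  also have "\<dots> = (\<Sum>i\<le>d. scale (t1 q \<theta> j) (u i))"
  proof (rule sum.cong)
    fix i
    assume "i \<in> {..d}"
    then show "scale (t1 q \<theta> i) (scale (t2 q \<theta> i j) (u i)) = scale (t1 q \<theta> j) (u i)"
      using t1_mult_t2[of i j] tridiagonal[OF jv u, of i] jv(1)
      by (cases "Suc i < j \<or> Suc j < i") auto
  qed simp
  also have "\<dots> = R fAstar (?H v)"
    by (simp add: H_map_eigenvector[OF jv] rep_scale u(2) scale_sum_right)
  finally show "(?H \<circ> R ?L) v = (R fAstar \<circ> ?H) v"
    by simp
qed (rule Vector_Spaces.linear_compose[OF rep_linear linear_H_map]
  Vector_Spaces.linear_compose[OF linear_H_map rep_linear])+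

end

section \<open>Modules over the q-Onsager algebra\<close>

lemma ideal_Oq_ideal: "ideal (Oq_ideal q) free_algebra"
  unfolding Oq_ideal_def
  by (rule ring.genideal_ideal[OF ring_free_algebra]) (simp add: free_algebra_def)

lemma Oq_class_surj: "X \<in> carrier (Oq q) \<Longrightarrow> \<exists>Y. X = Oq_class q Y"
  by (auto simp: Oq_def FactRing_def A_RCOSETS_def' Oq_class_def)

lemma Oq_class_in_carrier: "Oq_class q X \<in> carrier (Oq q)"
  using ring_hom_closed[OF Oq_class_hom] by (simp add: free_algebra_def)

lemma Oq_class_dolan_grady: "Oq_class q (q_dolan_grady q fA fAstar) = \<zero>\<^bsub>Oq q\<^esub>"
proof -
  have "q_dolan_grady q fA fAstar \<in> Oq_ideal q"
    unfolding Oq_ideal_def using ring.genideal_self[OF ring_free_algebra]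
    by (force simp: free_algebra_def)
  then show ?thesis
    using ring.a_rcos_zero[OF ring_free_algebra ideal_Oq_ideal]
    by (simp add: Oq_class_def Oq_def FactRing_def)
qed

text \<open>The homomorphism \<open>\<phi>\<close> allows for both cases that are compared later: the identity gives the
  module itself, and the Lusztig automorphism gives the twisted module.\<close>
lemma representation_of_Oq_hom:
  assumes "Oq_module q scale \<rho>" "\<phi> \<in> ring_hom (Oq q) (Oq q)"
    and "\<And>c. \<phi> (Oq_class q (scalar c)) = Oq_class q (scalar c)"
  shows "free_algebra_representation scale (\<lambda>X. \<rho> (\<phi> (Oq_class q X)))"
proof -
  have vs: "vector_space scale" and "\<rho> \<in> ring_hom (Oq q) (End_ring scale)"
    and sc: "\<And>c. \<rho> (Oq_class q (scalar c)) = scale c"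
    using assms(1) by (auto simp: Oq_module_def)
  then have hom: "\<rho> \<circ> (\<phi> \<circ> Oq_class q) \<in> ring_hom free_algebra (End_ring scale)"
    using assms(2) Oq_class_hom by (intro ring_hom_trans)
  show ?thesis
    using vs ring_hom_closed[OF hom] ring_hom_add[OF hom] ring_hom_mult[OF hom] sc assms(3)
    by (auto simp: free_algebra_representation_def free_algebra_representation_axioms_def
        free_algebra_def End_ring_def)
qed

text \<open>Preservation of zero is not part of the notion of \<open>ring_hom\<close>; it follows from additivity
  because \<open>'v\<close> is a group.\<close>
lemma Oq_module_zero:
  assumes "Oq_module q scale \<rho>"
  shows "\<rho> \<zero>\<^bsub>Oq q\<^esub> v = 0"
proof -
  interpret R: free_algebra_representation scale "\<lambda>X. \<rho> (id (Oq_class q X))"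
    using assms by (rule representation_of_Oq_hom) (auto simp: ring_hom_def)
  have "Oq_class q 0 = \<zero>\<^bsub>Oq q\<^esub>"
    using ring_hom_zero[OF Oq_class_hom ring_free_algebra ring_Oq, of q]
    by (simp add: free_algebra_def)
  then show ?thesis
    using R.rep_diff[of 0 0 v] by simp
qed

theorem proposition3p7:
  fixes q a :: "'f::field"
    and scale :: "'f \<Rightarrow> 'v::ab_group_add \<Rightarrow> 'v"
    and \<rho> :: "'f free_alg set \<Rightarrow> 'v \<Rightarrow> 'v"
    and \<theta> :: "nat \<Rightarrow> 'f"
    and d :: nat
    and L :: "'f free_alg set \<Rightarrow> 'f free_alg set"
    and H :: "'v \<Rightarrow> 'v"
  assumes "q \<noteq> 0" and "\<forall>n>0. q ^ n \<noteq> 1"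
    and "irreducible_Oq_module q scale \<rho>"
    and "\<exists>B. finite_dimensional_vector_space scale B"
    and "vector_space.dim scale (UNIV :: 'v set) \<ge> 2"
    and "diagonalizable scale (\<rho> (Oq_A q))"
    and "diagonalizable scale (\<rho> (Oq_Astar q))"
    and "d \<ge> 1" and "inj_on \<theta> {..d}"
    and "eigenvalues scale (\<rho> (Oq_A q)) = \<theta> ` {..d}"
    and "a \<noteq> 0"
    and "\<forall>i\<le>d. \<theta> i = a * q powi (int d - 2 * int i) + inverse a * q powi (2 * int i - int d)"
    and "lusztig_automorphism q L"
    and "H = H_map q scale (\<rho> (Oq_A q)) \<theta> d"
  shows "bij H \<and>
    (\<forall>X\<in>carrier (Oq q).
       \<rho> (L X) = inv_into UNIV H \<circ> \<rho> X \<circ> H \<and>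
       \<rho> (inv_into (carrier (Oq q)) L X) = H \<circ> \<rho> X \<circ> inv_into UNIV H)"
proof -
  have mod: "Oq_module q scale \<rho>"
    using assms(3) by (simp add: irreducible_Oq_module_def)
  have L: "L \<in> ring_hom (Oq q) (Oq q)" "bij_betw L (carrier (Oq q)) (carrier (Oq q))"
    "\<And>c. L (Oq_class q (scalar c)) = Oq_class q (scalar c)" "L (Oq_A q) = Oq_A q"
    "L (Oq_Astar q) = Oq_class q (fAstar + scalar (1 / ((q - inverse q) * (q\<^sup>2 - inverse q ^ 2)))
      * comm fA (qcomm q fA fAstar))"
    using assms(13) by (auto simp: lusztig_automorphism_def ring_iso_def)
  \<comment> \<open>the module and its twist by \<open>L\<close>, both as representations of the free algebra\<close>
  define R where "R X = \<rho> (Oq_class q X)" for X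
  define R' where "R' X = \<rho> (L (Oq_class q X))" for X
  have rep: "free_algebra_representation scale R"
    using representation_of_Oq_hom[OF mod, of id] by (simp add: ring_hom_def R_def[abs_def])
  have rep': "free_algebra_representation scale R'"
    using representation_of_Oq_hom[OF mod L(1,3)] by (simp add: R'_def[abs_def])
  interpret R: free_algebra_representation scale R
    by (rule rep)
  interpret R: dolan_grady_representation scale R q a \<theta> d
  proof (intro dolan_grady_representation.intro dolan_grady_representation_axioms.intro
      eigenspace_decomposition.intro eigenspace_decomposition_axioms.intro
      q_racah_eigenvalues.intro rep R.vector_space_axioms)
    show "Vector_Spaces.linear scale scale (R fA)"
      by (rule R.rep_linear)
    show "R.span (\<Union>i\<le>d. eigenspace scale (R fA) (\<theta> i)) = UNIV"
      using diagonalizable_imp_span_eigenspaces[OF R.vector_space_axioms] assms(6,10)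
      by (simp add: R_def)
    show "R (q_dolan_grady q fA fAstar) v = 0" for v
      using Oq_module_zero[OF mod] by (simp add: R_def Oq_class_dolan_grady)
  qed (use assms in auto)
  have H: "H = H_map q scale (R fA) \<theta> d"
    using assms(14) by (simp add: R_def)
  have bij: "bij H"
    unfolding H by (rule R.bij_H_map[OF R.t1_nonzero])
  have "H \<circ> R' X = R X \<circ> H" for X
  proof (rule representations_intertwined[OF rep rep'])
    show "H \<circ> R' fA = R fA \<circ> H"
      using R.H_map_commutes_fA unfolding H by (simp add: R'_def R_def L(4))
    show "H \<circ> R' fAstar = R fAstar \<circ> H"
      using R.H_map_intertwines_fAstar unfolding H R'_def L(5) unfolding R_def .
  qed (simp add: H R.linear_H_map)
  then have key: "H (\<rho> (L X) v) = \<rho> X (H v)" if "X \<in> carrier (Oq q)" for X v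
    using Oq_class_surj[OF that] by (auto simp: R_def R'_def fun_eq_iff)
  have inv: "inv_into UNIV H (H v) = v" "H (inv_into UNIV H v) = v" for v
    using bij by (simp_all add: bij_is_inj bij_is_surj surj_f_inv_f)
  have "\<rho> (L X) = inv_into UNIV H \<circ> \<rho> X \<circ> H" if "X \<in> carrier (Oq q)" for X
    using key[OF that] inv by (metis comp_apply ext)
  moreover have "\<rho> (inv_into (carrier (Oq q)) L X) = H \<circ> \<rho> X \<circ> inv_into UNIV H"
    if X: "X \<in> carrier (Oq q)" for X
  proof -
    have Y: "inv_into (carrier (Oq q)) L X \<in> carrier (Oq q)"
      "L (inv_into (carrier (Oq q)) L X) = X"
      using L(2) X by (auto simp: bij_betw_def inv_into_into f_inv_into_f)
    show ?thesis
      using key[OF Y(1)] Y(2) inv by (simp add: fun_eq_iff)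
  qed
  ultimately show ?thesis
    using bij by blast
qed

end
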